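(* Let $X$ be a complete noncompact length space with a universal cover and let $g\in\pi_1(X)$. If $L^\infty_{rs}(g)<2$, then any closed curve in $X$ representing $g$ has the loops to infinity property.
   Context: A complete length space is a complete metric space in which every pair of points is joined by a length-minimizing rectifiable curve whose length is the distance between the points. A universal cover $\tilde X$ of $X$ is a covering space of $X$ that covers every other covering space of $X$; it carries the lifted length metric, and each $g\in\pi_1(X)$ is viewed as a deck transformation of $\tilde X$. The infinite rescaled length of $g$ is $$L^\infty_{rs}(g)=\lim_{R\to\infty}\ \inf_{x\in X\setminus B_{x_0}(R)}\frac{d_{\tilde X}(g\tilde x,\tilde x)}{d_X(x,x_0)},$$ where $x_0\in X$ is any basepoint (the value does not depend on it) and $\tilde x$ ranges over the lifts of $x$ to $\tilde X$. A loop $\gamma:\mathbb S^1\to X$ has the loops to infinity property if for every compact set $K\subset X$ there is a loop $\sigma:\mathbb S^1\to X\setminus K$ freely homotopic to $\gamma$.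
   Formalization: The fundamental group is assumed to be identified bijectively with the deck group, so the universal cover is simply connected; otherwise the claim fails, e.g. for Griffiths' twin cone with a ray attached, which is its own universal cover. *)

theory Defs
  imports "HOL-Analysis.Analysis"
begin

definition curve_length :: "(real \<Rightarrow> 'a::metric_space) \<Rightarrow> ennreal" where
  "curve_length c =
     Sup {ennreal (\<Sum>i<n. dist (c (t i)) (c (t (Suc i)))) | (n::nat) (t::nat \<Rightarrow> real).
            mono t \<and> range t \<subseteq> {0..1}}"

text \<open>Completeness is not part of this definition: it is the sort \<open>complete_space\<close> of the type of
  points. A curve of length \<open>dist x y\<close> is automatically rectifiable and length-minimizing.\<close>

definition length_space :: "'a::metric_space itself \<Rightarrow> bool" where
  "length_space _ \<longleftrightarrow>
     (\<forall>x y :: 'a. \<exists>c. path c \<and> pathstart c = x \<and> pathfinish c = y \<and>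
                     curve_length c = ennreal (dist x y))"

text \<open>\<open>covering_space\<close>, for abstract topologies. Quantifying over all covering spaces inside a
  formula requires topologies as values; the type class only gives one topology per type.\<close>

definition covering_map :: "'c topology \<Rightarrow> 'd topology \<Rightarrow> ('c \<Rightarrow> 'd) \<Rightarrow> bool" where
  "covering_map E B p \<longleftrightarrow>
     continuous_map E B p \<and> p ` topspace E = topspace B \<and>
     (\<forall>x \<in> topspace B. \<exists>T. x \<in> T \<and> openin B T \<and>
        (\<exists>v. \<Union>v = topspace E \<inter> p -` T \<and>
             (\<forall>u \<in> v. openin E u) \<and>
             pairwise disjnt v \<and>
             (\<forall>u \<in> v. \<exists>q. homeomorphic_maps (subtopology E u) (subtopology B T) p q)))"

lemma covering_map_euclidean:
  fixes p :: "'b::topological_space \<Rightarrow> 'a::topological_space"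
  shows "covering_map euclidean euclidean p \<longleftrightarrow> covering_space UNIV p UNIV"
proof -
  have "homeomorphic_maps (top_of_set u) (top_of_set T) p q \<longleftrightarrow> homeomorphism u T p q"
    for u :: "'b set" and T :: "'a set" and q
    by (auto simp: homeomorphic_maps_def homeomorphism_def Pi_iff image_subset_iff)
       (metis image_eqI)+
  then show ?thesis
    by (simp add: covering_map_def covering_space_def)
qed

text \<open>The covering spaces to be covered are the connected ones (for covers of a length space,
  connected and path connected agree). Every path connected covering space \<open>q : E \<rightarrow> X\<close> has a copy
  with points of type \<open>(real \<Rightarrow> 'a) set\<close>: fix a point \<open>e\<close> of \<open>E\<close> and send a point \<open>y\<close> to the set of
  all \<open>q \<circ> c\<close> with \<open>c\<close> a path in \<open>E\<close> from \<open>e\<close> to \<open>y\<close>. So this type loses no covering space.\<close>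

definition universal_cover :: "('b::topological_space \<Rightarrow> 'a::topological_space) \<Rightarrow> bool" where
  "universal_cover p \<longleftrightarrow>
     covering_space UNIV p UNIV \<and> path_connected (UNIV::'b set) \<and>
     (\<forall>(E :: (real \<Rightarrow> 'a) set topology) q.
        path_connected_space E \<and> covering_map E euclidean q \<longrightarrow>
        (\<exists>f. covering_map euclidean E f \<and> (\<forall>y. q (f y) = p y)))"

definition lifted_dist ::
    "('b::topological_space \<Rightarrow> 'a::metric_space) \<Rightarrow> 'b \<Rightarrow> 'b \<Rightarrow> ennreal" where
  "lifted_dist p y z =
     (INF c \<in> {c. path c \<and> pathstart c = y \<and> pathfinish c = z}. curve_length (p \<circ> c))"

definition deck_transformations ::
    "('b::topological_space \<Rightarrow> 'a::topological_space) \<Rightarrow> ('b \<Rightarrow> 'b) set" where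
  "deck_transformations p = {h. (\<exists>k. homeomorphism UNIV UNIV h k) \<and> (\<forall>y. p (h y) = p y)}"

definition fundamental_group :: "'a::topological_space \<Rightarrow> (real \<Rightarrow> 'a) set set" where
  "fundamental_group b =
     {{\<beta>. homotopic_paths UNIV \<alpha> \<beta>} | \<alpha>. path \<alpha> \<and> pathstart \<alpha> = b \<and> pathfinish \<alpha> = b}"

text \<open>The identification \<open>\<Theta>\<close> of \<open>\<pi>\<^sub>1(X, p y\<^sub>0)\<close> with the deck transformations through which an
  element \<open>g\<close> is viewed as a deck transformation \<open>\<Theta> g\<close>: it moves \<open>y\<^sub>0\<close> to the end point of the lifts
  at \<open>y\<^sub>0\<close> of the loops in \<open>g\<close>. For a simply connected universal cover there is exactly one such
  \<open>\<Theta>\<close> (on the fundamental group). For a universal cover that is not simply connected, \<open>g\<close> is not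
  determined by the end points of the lifts, and there is none.\<close>

definition deck_identification ::
    "('b::topological_space \<Rightarrow> 'a::topological_space) \<Rightarrow> 'b \<Rightarrow>
     ((real \<Rightarrow> 'a) set \<Rightarrow> 'b \<Rightarrow> 'b) \<Rightarrow> bool" where
  "deck_identification p y\<^sub>0 \<Theta> \<longleftrightarrow>
     bij_betw \<Theta> (fundamental_group (p y\<^sub>0)) (deck_transformations p) \<and>
     (\<forall>g \<in> fundamental_group (p y\<^sub>0). \<forall>c.
        path c \<and> pathstart c = y\<^sub>0 \<and> p \<circ> c \<in> g \<longrightarrow> pathfinish c = \<Theta> g y\<^sub>0)"

text \<open>The infimum is over all lifts \<open>y\<close> of all points outside the ball. Values are extended reals,
  so that the limit over \<open>R\<close> of these nondecreasing infima always exists, and is \<open>\<infinity>\<close> if \<open>X\<close> is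
  bounded.\<close>

definition infinite_rescaled_length ::
    "('b::topological_space \<Rightarrow> 'a::metric_space) \<Rightarrow> 'a \<Rightarrow> ('b \<Rightarrow> 'b) \<Rightarrow> ennreal" where
  "infinite_rescaled_length p x\<^sub>0 h =
     Lim at_top (\<lambda>R::real.
       INF y \<in> {y. p y \<notin> ball x\<^sub>0 R}. lifted_dist p (h y) y / ennreal (dist (p y) x\<^sub>0))"

text \<open>Loops are paths \<open>\<gamma>\<close> on \<open>{0..1}\<close> with \<open>pathfinish \<gamma> = pathstart \<gamma>\<close>. A closed curve need not pass
  through the base point of the fundamental group, so representing \<open>g\<close> is up to free homotopy.\<close>

definition represents :: "(real \<Rightarrow> 'a::topological_space) \<Rightarrow> (real \<Rightarrow> 'a) set \<Rightarrow> bool" where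
  "represents \<gamma> g \<longleftrightarrow>
     path \<gamma> \<and> pathfinish \<gamma> = pathstart \<gamma> \<and> (\<exists>\<alpha> \<in> g. homotopic_loops UNIV \<gamma> \<alpha>)"

definition loops_to_infinity :: "(real \<Rightarrow> 'a::topological_space) \<Rightarrow> bool" where
  "loops_to_infinity \<gamma> \<longleftrightarrow>
     (\<forall>K. compact K \<longrightarrow>
        (\<exists>\<sigma>. path \<sigma> \<and> pathfinish \<sigma> = pathstart \<sigma> \<and> path_image \<sigma> \<subseteq> - K \<and>
             homotopic_loops UNIV \<sigma> \<gamma>))"

end

theory Submission
  imports Defs
begin

text \<open>
  If the rescaled length at infinity is less than \<open>2\<close>, then for some \<open>q < 2\<close> there are, arbitrarily
  far out, points \<open>x\<close> at distance \<open>d\<close> from the base point with a lift \<open>y\<close> that is joined to its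
  translate by a curve of length less than \<open>q d\<close>. This curve projects to a loop at \<open>x\<close>. No point
  of a loop is further from its base point than half the length, so the loop stays outside the ball of
  radius \<open>(1 - q/2) d\<close> about the base point, and this radius is as large as desired
  (\<open>far_short_displacement\<close> and \<open>curve_length_ge_detour\<close>).

  The loop is freely homotopic to every closed curve that represents \<open>g\<close>
  (\<open>projected_displacement_homotopic\<close>). Conjugating it with the projection of a path from \<open>y\<^sub>0\<close> to \<open>y\<close>
  gives a loop whose lift at \<open>y\<^sub>0\<close> ends at \<open>\<Theta> g y\<^sub>0\<close>. Its class \<open>g'\<close> therefore has a deck
  transformation that agrees with \<open>\<Theta> g\<close> at \<open>y\<^sub>0\<close>. Two deck transformations of a connected cover that
  agree at a point are equal, so \<open>g' = g\<close> because \<open>\<Theta>\<close> is injective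
  (\<open>projection_in_class_of_displacement\<close>).
\<close>

section \<open>Lifts and free homotopies in topological spaces\<close>

text \<open>Uniqueness of lifts, in arbitrary topological spaces. The set where two lifts agree is open because the covering map is injective on each sheet. Its complement is open because
  distinct points over the same point lie in different, hence disjoint, sheets.\<close>

lemma covering_space_lifts_eq:
  fixes p :: "'b::topological_space \<Rightarrow> 'a::topological_space"
    and h k :: "'c::topological_space \<Rightarrow> 'b"
  assumes cov: "covering_space UNIV p UNIV"
    and S: "connected S" "z \<in> S" "x \<in> S"
    and h: "continuous_on S h" and k: "continuous_on S k"
    and lift: "\<And>x. x \<in> S \<Longrightarrow> p (h x) = p (k x)"
    and z: "h z = k z"
  shows "h x = k x"
proof -
  define A where "A = {x \<in> S. h x = k x}"
  have sheets: "\<exists>U V. open U \<and> open V \<and> h y \<in> U \<and> k y \<in> V \<and> inj_on p U \<and> (U = V \<or> disjnt U V)"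
    if y: "y \<in> S" for y
  proof -
    have "\<forall>x. \<exists>T. x \<in> T \<and> open T \<and> (\<exists>v. \<Union>v = p -` T \<and> (\<forall>u\<in>v. open u) \<and> pairwise disjnt v \<and>
        (\<forall>u\<in>v. \<exists>q. homeomorphism u T p q))"
      using cov by (simp add: covering_space_def)
    from spec[OF this, of "p (h y)"] obtain T v where T: "p (h y) \<in> T"
      and v: "\<Union>v = p -` T" "\<forall>u\<in>v. open u" "pairwise disjnt v" "\<forall>u\<in>v. \<exists>q. homeomorphism u T p q"
      by (elim exE conjE)
    obtain U where U: "U \<in> v" "h y \<in> U"
      using v(1) T by (metis UnionE vimageI)
    obtain V where V: "V \<in> v" "k y \<in> V"
      using v(1) T lift[OF y] by (metis UnionE vimageI)
    have "inj_on p U"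
      using v(4) U(1) by (metis homeomorphism_def inj_on_inverseI)
    moreover have "U = V \<or> disjnt U V"
      using v(3) U V by (metis pairwiseD)
    ultimately show ?thesis
      using U V v(2) by blast
  qed
  have nbhd: "openin (top_of_set S) {x \<in> S. h x \<in> U \<and> k x \<in> V}" if "open U" "open V" for U V
  proof -
    have "openin (top_of_set S) ((S \<inter> h -` U) \<inter> (S \<inter> k -` V))"
      using that h k by (intro openin_Int continuous_openin_preimage_gen)
    moreover have "(S \<inter> h -` U) \<inter> (S \<inter> k -` V) = {x \<in> S. h x \<in> U \<and> k x \<in> V}"
      by blast
    ultimately show ?thesis
      by simp
  qed
  have "openin (top_of_set S) A"
  proof (subst openin_subopen, intro ballI)
    fix y assume y: "y \<in> A"
    then have "y \<in> S"
      by (simp add: A_def)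
    then obtain U where U: "open U" "h y \<in> U" "inj_on p U"
      using sheets by meson
    have "{x \<in> S. h x \<in> U \<and> k x \<in> U} \<subseteq> A"
      using U(3) lift by (auto simp: A_def inj_on_def)
    then show "\<exists>T. openin (top_of_set S) T \<and> y \<in> T \<and> T \<subseteq> A"
      using U(2) y by (intro exI[of _ "{x \<in> S. h x \<in> U \<and> k x \<in> U}"]) (simp add: nbhd U(1) A_def)
  qed
  moreover have "openin (top_of_set S) (S - A)"
  proof (subst openin_subopen, intro ballI)
    fix y assume y: "y \<in> S - A"
    then have y': "y \<in> S" "h y \<noteq> k y"
      by (auto simp: A_def)
    obtain U V where U: "open U" "open V" "h y \<in> U" "k y \<in> V" "inj_on p U"
        and eq: "U = V \<or> disjnt U V"
      using sheets[OF y'(1)] by (elim exE conjE)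
    have "disjnt U V"
      using eq inj_onD[OF U(5) lift[OF y'(1)] U(3)] U(4) y'(2) by blast
    then have "{x \<in> S. h x \<in> U \<and> k x \<in> V} \<subseteq> S - A"
      by (auto simp: A_def disjnt_iff)
    then show "\<exists>T. openin (top_of_set S) T \<and> y \<in> T \<and> T \<subseteq> S - A"
      using U y' by (intro exI[of _ "{x \<in> S. h x \<in> U \<and> k x \<in> V}"]) (simp add: nbhd)
  qed
  moreover have "A \<subseteq> S" "z \<in> A"
    using S z by (auto simp: A_def)
  ultimately have "A = S"
    using S(1) unfolding connected_clopen closedin_def by auto
  then show ?thesis
    using S by (auto simp: A_def)
qed

text \<open>The intermediate loops run along the conjugated loop between the times \<open>t/2\<close> and \<open>1 - t/4\<close>, at
  which it visits the same point \<open>a t\<close>. All of them are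
  reparametrized parts of one loop, so continuity only concerns the parameter.\<close>

lemma homotopic_loops_conjugate_topological:
  fixes a b :: "real \<Rightarrow> 'a::topological_space"
  assumes "path a" "path b" "path_image a \<subseteq> S" "path_image b \<subseteq> S"
    and ab: "pathfinish a = pathstart b" and b: "pathfinish b = pathstart b"
  shows "homotopic_loops S (a +++ b +++ reversepath a) b"
proof -
  define J where "J = a +++ b +++ reversepath a"
  define \<tau> where "\<tau> = (\<lambda>x::real \<times> real. (1 - snd x) * (fst x / 2) + snd x * (1 - fst x / 4))"
  have J: "path J" "path_image J \<subseteq> S"
    using assms by (auto simp: J_def path_image_join)
  have \<tau>: "\<tau> ` ({0..1} \<times> {0..1}) \<subseteq> {0..1}"
  proof clarify
    fix t s :: real assume t: "t \<in> {0..1}" and s: "s \<in> {0..1}"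
    have "(1 - s) * (t/2) + s * (1 - t/4) \<in> {0..1}"
      using convexD_alt[OF convex_real_interval(5), of "t/2" 0 1 "1 - t/4" s] t s by auto
    then show "\<tau> (t, s) \<in> {0..1}"
      by (simp add: \<tau>_def)
  qed
  have "continuous_on ({0..1} \<times> {0..1}) \<tau>"
    unfolding \<tau>_def by (intro continuous_intros) auto
  then have cont: "continuous_on ({0..1} \<times> {0..1}) (J \<circ> \<tau>)"
    using J(1) \<tau> by (meson continuous_on_compose continuous_on_subset path_def)
  have im: "J ` \<tau> ` ({0..1} \<times> {0..1}) \<subseteq> S"
    using J(2) \<tau> by (force simp: path_image_def)
  have start: "(J \<circ> \<tau>) (0, s) = J s" for s
    by (simp add: \<tau>_def)
  have finish: "(J \<circ> \<tau>) (1, s) = b s" if "s \<in> {0..1}" for s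
  proof -
    have "\<tau> (1, s) = 1/2 + s/4"
      by (simp add: \<tau>_def field_simps)
    then show ?thesis
      using that ab b
      by (auto simp: J_def joinpaths_def pathfinish_def pathstart_def algebra_simps)
  qed
  have loop: "(J \<circ> \<tau>) (t, 1) = (J \<circ> \<tau>) (t, 0)" if "t \<in> {0..1}" for t
    using that ab b
    by (auto simp: \<tau>_def J_def joinpaths_def reversepath_def pathfinish_def pathstart_def)
  show ?thesis
    unfolding homotopic_loops J_def[symmetric]
    using cont im start finish loop
    by (intro exI[of _ "J \<circ> \<tau>"]) (auto simp: pathfinish_def pathstart_def image_comp)
qed

section \<open>Loops representing a deck transformation\<close>

text \<open>\<open>deck_identification\<close> gives the end point of a lift from the class of its projection. The converse
  holds because a deck transformation is determined by one value and \<open>\<Theta>\<close> is injective.\<close>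

lemma projection_in_class_of_displacement:
  fixes p :: "'b::topological_space \<Rightarrow> 'a::topological_space"
  assumes cov: "covering_space UNIV p UNIV" and conn: "connected (UNIV :: 'b set)"
    and \<Theta>: "deck_identification p y\<^sub>0 \<Theta>" and g: "g \<in> fundamental_group (p y\<^sub>0)"
    and e: "path e" "pathstart e = y\<^sub>0" "pathfinish e = \<Theta> g y\<^sub>0"
  shows "p \<circ> e \<in> g"
proof -
  have bij: "bij_betw \<Theta> (fundamental_group (p y\<^sub>0)) (deck_transformations p)"
    using \<Theta> by (simp add: deck_identification_def)
  have deck: "continuous_on UNIV (\<Theta> f)" "p (\<Theta> f y) = p y" if "f \<in> fundamental_group (p y\<^sub>0)" for f y
    using bij_betwE[OF bij] that
    by (auto simp: deck_transformations_def homeomorphism_def)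
  have pe: "path (p \<circ> e)"
    using e(1) covering_space_imp_continuous[OF cov]
    by (blast intro: path_continuous_image continuous_on_subset)
  define g' where "g' = {\<beta>. homotopic_paths UNIV (p \<circ> e) \<beta>}"
  have g': "g' \<in> fundamental_group (p y\<^sub>0)"
    unfolding fundamental_group_def g'_def
    using pe e deck(2)[OF g] by (auto simp: pathstart_compose pathfinish_compose)
  have mem: "p \<circ> e \<in> g'"
    using pe by (simp add: g'_def)
  have base: "\<Theta> g y\<^sub>0 = \<Theta> g' y\<^sub>0"
    using \<Theta> g' mem e by (auto simp: deck_identification_def)
  have "p (\<Theta> g y) = p (\<Theta> g' y)" for y
    using deck(2)[OF g, of y] deck(2)[OF g', of y] by simp
  then have "\<Theta> g y = \<Theta> g' y" for y
    using covering_space_lifts_eq[OF cov conn UNIV_I UNIV_I deck(1)[OF g] deck(1)[OF g'] _ base]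
    by blast
  then have "\<Theta> g = \<Theta> g'"
    by (rule ext)
  then have "g = g'"
    using inj_onD[OF bij_betw_imp_inj_on[OF bij]] g g' by blast
  then show ?thesis
    using mem by simp
qed

text \<open>The point \<open>y\<close> is arbitrary, while \<open>\<Theta>\<close> is described at \<open>y\<^sub>0\<close> only. A path \<open>w\<close> from \<open>y\<^sub>0\<close> to \<open>y\<close>
  and its translate under \<open>\<Theta> g\<close> have the same projection, so they extend \<open>c\<close> to a path from \<open>y\<^sub>0\<close> to
  \<open>\<Theta> g y\<^sub>0\<close> whose projection is a conjugate of that of \<open>c\<close>.\<close>

lemma projected_displacement_homotopic:
  fixes p :: "'b::topological_space \<Rightarrow> 'a::topological_space"
  assumes cov: "covering_space UNIV p UNIV" and pconn: "path_connected (UNIV :: 'b set)"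
    and \<Theta>: "deck_identification p y\<^sub>0 \<Theta>" and g: "g \<in> fundamental_group (p y\<^sub>0)"
    and \<gamma>: "represents \<gamma> g"
    and c: "path c" "pathstart c = y" "pathfinish c = \<Theta> g y"
  shows "homotopic_loops UNIV (p \<circ> c) \<gamma>"
proof -
  have "\<Theta> g \<in> deck_transformations p"
    using \<Theta> g by (auto simp: deck_identification_def bij_betw_def)
  then have deck: "continuous_on UNIV (\<Theta> g)" "\<And>y. p (\<Theta> g y) = p y"
    by (auto simp: deck_transformations_def homeomorphism_def)
  have pr: "path (p \<circ> f)" if "path f" for f
    using that covering_space_imp_continuous[OF cov]
    by (blast intro: path_continuous_image continuous_on_subset)
  obtain w where w: "path w" "pathstart w = y\<^sub>0" "pathfinish w = y"
    using pconn by (auto simp: path_connected_def)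
  define e where "e = w +++ c +++ (\<Theta> g \<circ> reversepath w)"
  have "path (\<Theta> g \<circ> reversepath w)"
    using w(1) deck(1) by (blast intro: path_continuous_image continuous_on_subset path_reversepath[THEN iffD2])
  then have e: "path e" "pathstart e = y\<^sub>0" "pathfinish e = \<Theta> g y\<^sub>0"
    using w c by (auto simp: e_def pathstart_compose pathfinish_compose)
  have "p \<circ> (\<Theta> g \<circ> reversepath w) = reversepath (p \<circ> w)"
    using deck(2) by (auto simp: reversepath_def)
  then have pe: "p \<circ> e = (p \<circ> w) +++ (p \<circ> c) +++ reversepath (p \<circ> w)"
    by (simp add: e_def path_compose_join)
  have "homotopic_loops UNIV (p \<circ> e) (p \<circ> c)"
    unfolding pe using pr w c deck(2)
    by (intro homotopic_loops_conjugate_topological) (auto simp: pathstart_compose pathfinish_compose)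
  moreover have "p \<circ> e \<in> g"
    using projection_in_class_of_displacement[OF cov path_connected_imp_connected[OF pconn] \<Theta> g e] .
  moreover obtain \<beta> where \<beta>: "\<beta> \<in> g" "homotopic_loops UNIV \<gamma> \<beta>"
    using \<gamma> by (auto simp: represents_def)
  moreover have "homotopic_loops UNIV (p \<circ> e) \<beta>"
  proof (rule homotopic_paths_imp_homotopic_loops)
    obtain \<alpha> where "homotopic_paths UNIV \<alpha> (p \<circ> e)" "homotopic_paths UNIV \<alpha> \<beta>"
      using g \<open>p \<circ> e \<in> g\<close> \<beta>(1) by (auto simp: fundamental_group_def)
    then show hp: "homotopic_paths UNIV (p \<circ> e) \<beta>"
      by (meson homotopic_paths_sym homotopic_paths_trans)
    show "pathfinish (p \<circ> e) = pathstart (p \<circ> e)"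
      using e deck(2) by (simp add: pathstart_compose pathfinish_compose)
    then show "pathfinish \<beta> = pathstart (p \<circ> e)"
      using homotopic_paths_imp_pathfinish[OF hp] by simp
  qed
  ultimately show ?thesis
    by (meson homotopic_loops_sym homotopic_loops_trans)
qed

section \<open>Short loops far away\<close>

lemma curve_length_ge_detour:
  fixes c :: "real \<Rightarrow> 'a::metric_space"
  assumes s: "s \<in> {0..1}"
  shows "ennreal (dist (c 0) (c s) + dist (c s) (c 1)) \<le> curve_length c"
proof -
  define t where "t = (\<lambda>i::nat. if i = 0 then 0 else if i = 1 then s else (1::real))"
  have "mono t" "range t \<subseteq> {0..1}"
    using s by (auto simp: t_def mono_def)
  moreover have "(\<Sum>i<2. dist (c (t i)) (c (t (Suc i)))) = dist (c 0) (c s) + dist (c s) (c 1)"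
    by (simp add: t_def numeral_2_eq_2)
  ultimately show ?thesis
    unfolding curve_length_def by (intro Sup_upper) (metis (mono_tags, lifting) mem_Collect_eq)
qed

lemma tendsto_SUP_at_top:
  fixes f :: "real \<Rightarrow> ennreal"
  assumes "mono f"
  shows "(f \<longlongrightarrow> (SUP R. f R)) at_top"
proof (rule order_tendstoI)
  fix l assume "l < (SUP R. f R)"
  then obtain R where "l < f R"
    by (auto simp: less_SUP_iff)
  then show "\<forall>\<^sub>F x in at_top. l < f x"
    using assms by (auto simp: eventually_at_top_linorder mono_def intro: less_le_trans)
next
  fix u assume "(SUP R. f R) < u"
  then show "\<forall>\<^sub>F x in at_top. f x < u"
    by (intro always_eventually) (meson SUP_upper UNIV_I le_less_trans)
qed

text \<open>The infima in the definition of the rescaled length increase with \<open>R\<close>, so each of them is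
  bounded by the limit; a single \<open>q\<close> serves for all radii.\<close>

lemma far_short_displacement:
  fixes p :: "'b::topological_space \<Rightarrow> 'a::metric_space"
  assumes "infinite_rescaled_length p x\<^sub>0 h < ennreal b"
  obtains q where "0 \<le> q" "q < b"
    "\<And>R. R > 0 \<Longrightarrow> \<exists>y c. R \<le> dist (p y) x\<^sub>0 \<and> path c \<and> pathstart c = h y \<and> pathfinish c = y \<and>
               curve_length (p \<circ> c) < ennreal (q * dist (p y) x\<^sub>0)"
proof -
  define f where "f = (\<lambda>R::real. INF y \<in> {y. p y \<notin> ball x\<^sub>0 R}.
    lifted_dist p (h y) y / ennreal (dist (p y) x\<^sub>0))"
  have "mono f"
    unfolding f_def by (intro monoI INF_superset_mono) auto
  then have "infinite_rescaled_length p x\<^sub>0 h = (SUP R. f R)"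
    unfolding infinite_rescaled_length_def f_def[symmetric]
    by (intro tendsto_Lim tendsto_SUP_at_top) auto
  then have "(SUP R. f R) < ennreal b"
    using assms by simp
  then obtain r where r: "(SUP R. f R) < r" "r < ennreal b"
    using dense by blast
  then obtain q where q: "0 \<le> q" "r = ennreal q"
    by (cases r) auto
  show ?thesis
  proof
    show "0 \<le> q" "q < b"
      using q r by (auto simp: ennreal_less_iff)
    fix R :: real assume R: "R > 0"
    have "f R < ennreal q"
      using r(1) q(2) by (meson SUP_upper UNIV_I le_less_trans)
    then obtain y where y: "p y \<notin> ball x\<^sub>0 R"
        "lifted_dist p (h y) y / ennreal (dist (p y) x\<^sub>0) < ennreal q"
      by (auto simp: f_def INF_less_iff)
    have d: "R \<le> dist (p y) x\<^sub>0"
      using y(1) by (simp add: dist_commute)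
    then have "lifted_dist p (h y) y < ennreal (q * dist (p y) x\<^sub>0)"
      using y(2) R q(1) by (subst (asm) divide_less_ennreal) (auto simp: ennreal_mult)
    then show "\<exists>y c. R \<le> dist (p y) x\<^sub>0 \<and> path c \<and> pathstart c = h y \<and> pathfinish c = y \<and>
               curve_length (p \<circ> c) < ennreal (q * dist (p y) x\<^sub>0)"
      using d by (auto simp: lifted_dist_def INF_less_iff)
  qed
qed

theorem lemma6p2:
  fixes p :: "'b::topological_space \<Rightarrow> 'a::complete_space"
    and y\<^sub>0 :: 'b and x\<^sub>0 :: 'a
    and \<Theta> :: "(real \<Rightarrow> 'a) set \<Rightarrow> 'b \<Rightarrow> 'b"
    and g :: "(real \<Rightarrow> 'a) set" and \<gamma> :: "real \<Rightarrow> 'a"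
  assumes "length_space TYPE('a)"
    and "\<not> compact (UNIV :: 'a set)"
    and "universal_cover p"
    and "deck_identification p y\<^sub>0 \<Theta>"
    and "g \<in> fundamental_group (p y\<^sub>0)"
    and "infinite_rescaled_length p x\<^sub>0 (\<Theta> g) < 2"
    and "represents \<gamma> g"
  shows "loops_to_infinity \<gamma>"
  unfolding loops_to_infinity_def
proof (intro allI impI)
  fix K :: "'a set" assume "compact K"
  have cov: "covering_space UNIV p UNIV" and pconn: "path_connected (UNIV :: 'b set)"
    using assms(3) by (auto simp: universal_cover_def)
  obtain r where r: "r > 0" "K \<subseteq> ball x\<^sub>0 r"
    using bounded_subset_ballD[OF compact_imp_bounded[OF \<open>compact K\<close>]] by blast
  obtain q where q: "q < 2" and far: "\<And>R. R > 0 \<Longrightarrow> \<exists>y c. R \<le> dist (p y) x\<^sub>0 \<and> path c \<and>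
      pathstart c = \<Theta> g y \<and> pathfinish c = y \<and> curve_length (p \<circ> c) < ennreal (q * dist (p y) x\<^sub>0)"
    using far_short_displacement[OF assms(6)[folded ennreal_numeral]] by metis
  \<comment> \<open>Chosen so that a loop of length at most \<open>q d\<close>, based at distance \<open>d \<ge> R\<close> from \<open>x\<^sub>0\<close>, keeps
    distance \<open>d - q d / 2 \<ge> r\<close> from \<open>x\<^sub>0\<close>.\<close>
  define R where "R = r / (1 - q/2)"
  have "R > 0"
    using r(1) q by (simp add: R_def)
  then obtain y c where y: "R \<le> dist (p y) x\<^sub>0"
      and c: "path c" "pathstart c = \<Theta> g y" "pathfinish c = y"
      and short: "curve_length (p \<circ> c) < ennreal (q * dist (p y) x\<^sub>0)"
    using far by blast
  have "\<Theta> g \<in> deck_transformations p"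
    using assms(4,5) by (auto simp: deck_identification_def bij_betw_def)
  then have same: "p (\<Theta> g y) = p y"
    by (simp add: deck_transformations_def)
  \<comment> \<open>The curve \<open>c\<close> ends at \<open>y\<close>; reversed, it leads from \<open>y\<close> to its translate, as \<open>g\<close> requires.\<close>
  define \<sigma> where "\<sigma> = p \<circ> reversepath c"
  have "path \<sigma>"
    using c(1) covering_space_imp_continuous[OF cov] unfolding \<sigma>_def
    by (blast intro: path_continuous_image continuous_on_subset path_reversepath[THEN iffD2])
  moreover have "pathfinish \<sigma> = pathstart \<sigma>"
    using c same by (simp add: \<sigma>_def pathstart_compose pathfinish_compose)
  moreover have "homotopic_loops UNIV \<sigma> \<gamma>"
    unfolding \<sigma>_def using c
    by (intro projected_displacement_homotopic[OF cov pconn assms(4,5,7), of _ y]) auto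
  moreover have "path_image \<sigma> \<subseteq> - K"
  proof
    fix x assume "x \<in> path_image \<sigma>"
    then have "x \<in> (p \<circ> c) ` {0..1}"
      by (simp add: \<sigma>_def path_compose_reversepath) (simp add: path_image_def)
    then obtain s where s: "s \<in> {0..1}" "x = p (c s)"
      by auto
    have "p (c 0) = p y" "p (c 1) = p y"
      using c same by (auto simp: pathstart_def pathfinish_def)
    then have "ennreal (2 * dist (p y) x) < ennreal (q * dist (p y) x\<^sub>0)"
      using le_less_trans[OF curve_length_ge_detour[OF s(1), of "p \<circ> c"] short] s(2)
      by (simp add: dist_commute)
    then have "2 * dist (p y) x < q * dist (p y) x\<^sub>0"
      by (simp add: ennreal_less_iff)
    moreover have "dist (p y) x\<^sub>0 \<le> dist (p y) x + dist x\<^sub>0 x"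
      by (metis dist_commute dist_triangle)
    moreover have "r \<le> (1 - q/2) * dist (p y) x\<^sub>0"
      using y q by (simp add: R_def pos_divide_le_eq mult.commute)
    ultimately have "r < dist x\<^sub>0 x"
      by (simp add: algebra_simps)
    then show "x \<in> - K"
      using r(2) by auto
  qed
  ultimately show "\<exists>\<sigma>. path \<sigma> \<and> pathfinish \<sigma> = pathstart \<sigma> \<and> path_image \<sigma> \<subseteq> - K \<and>
      homotopic_loops UNIV \<sigma> \<gamma>"
    by blast
qed

end
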